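(* Let $(X,d)$ be a cone metric space over a real Banach space $E$ with cone $P$, let $I$ be an admissible ideal in $\mathbb{N}$, let $r\in E$ with $0\ll r$ or $r=0$, and let $\{x_n\}$ be a sequence in $X$. Then the rough $I$-limit set of $\{x_n\}$ of roughness degree $r$ equals the rough $I^*$-limit set of $\{x_n\}$ of roughness degree $r$ if and only if $I$ has the property (AP).
   Context: Let $E$ be a real Banach space with zero element $0$. A subset $P\subset E$ is a cone if (i) $P$ is closed, nonempty and $P\neq\{0\}$; (ii) $ax+by\in P$ for all $x,y\in P$ and real $a,b\ge 0$; (iii) $x\in P$ and $-x\in P$ imply $x=0$. For $x,y\in E$: $x\le y$ means $y-x\in P$; $x<y$ means $x\le y$ and $x\ne y$; $x\ll y$ means $y-x\in\operatorname{int}P$. A cone metric space $(X,d)$ is a nonempty set $X$ with a map $d:X\times X\to E$ such that $0\le d(x,y)$, $d(x,y)=0$ iff $x=y$, $d(x,y)=d(y,x)$, and $d(x,y)\le d(x,z)+d(z,y)$ for all $x,y,z\in X$. An ideal $I$ in $\mathbb{N}$ is a family of subsets of $\mathbb{N}$ closed under finite unions and under taking subsets; it is admissible if $I\ne\{\emptyset\}$, $\mathbb{N}\notin I$, and $\{n\}\in I$ for each $n\in\mathbb{N}$. Its associated filter is $F(I)=\{\mathbb{N}\setminus A: A\in I\}$. An admissible ideal $I$ has the property (AP) if for every sequence $A_1,A_2,\dots$ of mutually disjoint sets in $I$ there is a sequence $B_1,B_2,\dots$ of subsets of $\mathbb{N}$ such that $A_i\Delta B_i$ is finite for each $i$ and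 $\bigcup_{j\in\mathbb{N}}B_j\in I$. A sequence $\{x_n\}$ in $X$ is rough $I$-convergent of roughness degree $r$ to $x\in X$ (where $0\ll r$ or $r=0$) if for every $\varepsilon\in E$ with $0\ll\varepsilon$ the set $\{n\in\mathbb{N}: r+\varepsilon-d(x_n,x)\notin\operatorname{int}P\}$ belongs to $I$. It is rough $I^*$-convergent of roughness degree $r$ to $x$ if there is a set $M=\{m_1<m_2<\cdots<m_k<\cdots\}\in F(I)$ such that for every $\varepsilon\in E$ with $0\ll\varepsilon$ there is $k\in\mathbb{N}$ with $d(x_{m_p},x)\ll r+\varepsilon$ for all $p\ge k$. The rough $I$-limit set (respectively rough $I^*$-limit set) of $\{x_n\}$ of roughness degree $r$ is the set of all $x\in X$ to which $\{x_n\}$ is rough $I$-convergent (respectively rough $I^*$-convergent) of roughness degree $r$.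
   Formalization: As stated, "only if" fails (constant sequence, I without (AP)). Proved: (AP) gives equality for every space and sequence; conversely, if int P is nonempty and equality holds for all cone metric spaces over E, P with carrier inside a given infinite set and all their sequences, I has (AP). *)

theory Defs
  imports "HOL-Analysis.Analysis"
begin

definition is_cone :: "'e::banach set \<Rightarrow> bool" where
  "is_cone P \<longleftrightarrow>
     closed P \<and> P \<noteq> {} \<and> P \<noteq> {0} \<and>
     (\<forall>x\<in>P. \<forall>y\<in>P. \<forall>a b::real. 0 \<le> a \<longrightarrow> 0 \<le> b \<longrightarrow> a *\<^sub>R x + b *\<^sub>R y \<in> P) \<and>
     (\<forall>x. x \<in> P \<longrightarrow> - x \<in> P \<longrightarrow> x = 0)"

definition cone_le :: "'e::banach set \<Rightarrow> 'e \<Rightarrow> 'e \<Rightarrow> bool" where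
  "cone_le P x y \<longleftrightarrow> y - x \<in> P"

definition cone_ll :: "'e::banach set \<Rightarrow> 'e \<Rightarrow> 'e \<Rightarrow> bool" where
  "cone_ll P x y \<longleftrightarrow> y - x \<in> interior P"

definition cone_metric_space ::
    "'e::banach set \<Rightarrow> 'a set \<Rightarrow> ('a \<Rightarrow> 'a \<Rightarrow> 'e) \<Rightarrow> bool" where
  "cone_metric_space P X d \<longleftrightarrow>
     X \<noteq> {} \<and>
     (\<forall>x\<in>X. \<forall>y\<in>X. cone_le P 0 (d x y)) \<and>
     (\<forall>x\<in>X. \<forall>y\<in>X. d x y = 0 \<longleftrightarrow> x = y) \<and>
     (\<forall>x\<in>X. \<forall>y\<in>X. d x y = d y x) \<and>
     (\<forall>x\<in>X. \<forall>y\<in>X. \<forall>z\<in>X. cone_le P (d x y) (d x z + d z y))"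

definition nat_ideal :: "nat set set \<Rightarrow> bool" where
  "nat_ideal I \<longleftrightarrow>
     (\<forall>A\<in>I. \<forall>B\<in>I. A \<union> B \<in> I) \<and> (\<forall>A\<in>I. \<forall>B. B \<subseteq> A \<longrightarrow> B \<in> I)"

definition admissible_ideal :: "nat set set \<Rightarrow> bool" where
  "admissible_ideal I \<longleftrightarrow>
     nat_ideal I \<and> I \<noteq> {{}} \<and> UNIV \<notin> I \<and> (\<forall>n. {n} \<in> I)"

definition ideal_filter :: "nat set set \<Rightarrow> nat set set" where
  "ideal_filter I = {UNIV - A |A. A \<in> I}"

definition property_AP :: "nat set set \<Rightarrow> bool" where
  "property_AP I \<longleftrightarrow>
     (\<forall>A::nat \<Rightarrow> nat set. (\<forall>i. A i \<in> I) \<and> disjoint_family A \<longrightarrow>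
        (\<exists>B::nat \<Rightarrow> nat set.
           (\<forall>i. finite ((A i - B i) \<union> (B i - A i))) \<and> (\<Union>j. B j) \<in> I))"

definition rough_I_convergent ::
    "'e::banach set \<Rightarrow> ('a \<Rightarrow> 'a \<Rightarrow> 'e) \<Rightarrow> nat set set \<Rightarrow> 'e \<Rightarrow> (nat \<Rightarrow> 'a) \<Rightarrow> 'a \<Rightarrow> bool" where
  "rough_I_convergent P d I r x l \<longleftrightarrow>
     (\<forall>\<epsilon>. cone_ll P 0 \<epsilon> \<longrightarrow> {n. r + \<epsilon> - d (x n) l \<notin> interior P} \<in> I)"

text \<open>The strictly increasing map \<open>m\<close> enumerates \<open>M = {m 0 < m 1 < \<dots>}\<close>.\<close>

definition rough_Istar_convergent ::
    "'e::banach set \<Rightarrow> ('a \<Rightarrow> 'a \<Rightarrow> 'e) \<Rightarrow> nat set set \<Rightarrow> 'e \<Rightarrow> (nat \<Rightarrow> 'a) \<Rightarrow> 'a \<Rightarrow> bool" where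
  "rough_Istar_convergent P d I r x l \<longleftrightarrow>
     (\<exists>m::nat \<Rightarrow> nat. strict_mono m \<and> range m \<in> ideal_filter I \<and>
        (\<forall>\<epsilon>. cone_ll P 0 \<epsilon> \<longrightarrow> (\<exists>k. \<forall>p\<ge>k. cone_ll P (d (x (m p)) l) (r + \<epsilon>))))"

definition rough_I_limit_set ::
    "'e::banach set \<Rightarrow> 'a set \<Rightarrow> ('a \<Rightarrow> 'a \<Rightarrow> 'e) \<Rightarrow> nat set set \<Rightarrow> 'e \<Rightarrow> (nat \<Rightarrow> 'a) \<Rightarrow> 'a set" where
  "rough_I_limit_set P X d I r x = {l \<in> X. rough_I_convergent P d I r x l}"

definition rough_Istar_limit_set ::
    "'e::banach set \<Rightarrow> 'a set \<Rightarrow> ('a \<Rightarrow> 'a \<Rightarrow> 'e) \<Rightarrow> nat set set \<Rightarrow> 'e \<Rightarrow> (nat \<Rightarrow> 'a) \<Rightarrow> 'a set" where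
  "rough_Istar_limit_set P X d I r x = {l \<in> X. rough_Istar_convergent P d I r x l}"

end

theory Submission
  imports Defs
begin

text \<open>
  A rough \<open>I\<^sup>*\<close>-limit is always a rough \<open>I\<close>-limit, because the exceptional indices of a tail form a
  finite set, which an admissible ideal contains. Everything else rests on the fact that for
  \<open>e\<close> in the interior of the cone the vectors \<open>e / (k + 1)\<close> get below every \<open>\<epsilon> \<ggreater> 0\<close>
  (\<open>eventually_interior_minus_scaled\<close>), so that countably many tolerances suffice to test
  convergence.

  If \<open>I\<close> has (AP), the bad sets of these tolerances, made disjoint, can be altered by finite
  sets so that their union lies in \<open>I\<close>. Outside that union only finitely many indices are bad
  for each tolerance, which is rough \<open>I\<^sup>*\<close>-convergence
  (\<open>AP_imp_rough_Istar_convergent\<close>).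

  Conversely, let \<open>A 0, A 1, \<dots>\<close> be disjoint members of \<open>I\<close>. Take a star-shaped space whose
  \<open>i\<close>-th outer point lies at distance \<open>r + e / (i + 1)\<close> from the centre, and the sequence that
  sits at the \<open>i\<close>-th outer point on \<open>A i\<close> and at the centre elsewhere. For a given tolerance
  only finitely many of the \<open>A i\<close> are bad, so the centre is a rough \<open>I\<close>-limit. If it
  is a rough \<open>I\<^sup>*\<close>-limit along \<open>M\<close>, then \<open>M\<close> meets each \<open>A i\<close> in a finite set, and \<open>A i - M\<close>
  are the sets that (AP) asks for. The space is countably infinite, so it can be placed inside
  any infinite type.
\<close>

section \<open>Cones and their interiors\<close>

lemma cone_add:
  assumes "is_cone P" "x \<in> P" "y \<in> P"
  shows "x + y \<in> P"
proof -
  have "1 *\<^sub>R x + 1 *\<^sub>R y \<in> P"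
    using assms unfolding is_cone_def by (meson zero_le_one)
  then show ?thesis by simp
qed

lemma cone_scale:
  assumes "is_cone P" "x \<in> P" "0 \<le> c"
  shows "c *\<^sub>R x \<in> P"
proof -
  have "c *\<^sub>R x + 0 *\<^sub>R x \<in> P"
    using assms unfolding is_cone_def by (meson order_refl)
  then show ?thesis by simp
qed

lemma cone_zero:
  assumes "is_cone P"
  shows "0 \<in> P"
proof -
  obtain v where "v \<in> P"
    using assms unfolding is_cone_def by blast
  then show ?thesis
    using cone_scale[OF assms, of v 0] by simp
qed

lemma interior_cone_add:
  assumes P: "is_cone P" and x: "x \<in> interior P" and y: "y \<in> P"
  shows "x + y \<in> interior P"
proof -
  have "(+) y ` interior P \<subseteq> P"
    using cone_add[OF P y] interior_subset[of P] by auto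
  moreover have "open ((+) y ` interior P)"
    by (intro open_translation open_interior)
  ultimately have "(+) y ` interior P \<subseteq> interior P"
    by (rule interior_maximal)
  with x show ?thesis by (auto simp: add.commute)
qed

lemma interior_cone_scale:
  assumes P: "is_cone P" and x: "x \<in> interior P" and c: "0 < c"
  shows "c *\<^sub>R x \<in> interior P"
proof -
  have "(*\<^sub>R) c ` interior P \<subseteq> P"
    using cone_scale[OF P] c interior_subset[of P] by auto
  moreover have "open ((*\<^sub>R) c ` interior P)"
    using c by (intro open_scaling open_interior) auto
  ultimately have "(*\<^sub>R) c ` interior P \<subseteq> interior P"
    by (rule interior_maximal)
  with x show ?thesis by auto
qed

text \<open>
  A neighbourhood of \<open>0\<close> inside \<open>P\<close> would contain a small negative multiple of a nonzero vector
  of \<open>P\<close>, against the pointedness of \<open>P\<close>.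
\<close>

lemma zero_notin_interior_cone:
  assumes P: "is_cone P"
  shows "0 \<notin> interior P"
proof
  assume "0 \<in> interior P"
  obtain v where v: "v \<in> P" "v \<noteq> 0"
    using P unfolding is_cone_def by blast
  have "(\<lambda>n. - (inverse (real (Suc n)) *\<^sub>R v)) \<longlonglongrightarrow> - (0 *\<^sub>R v)"
    by (intro tendsto_intros LIMSEQ_inverse_real_of_nat)
  then have "\<forall>\<^sub>F n in sequentially. - (inverse (real (Suc n)) *\<^sub>R v) \<in> interior P"
    using \<open>0 \<in> interior P\<close> by (intro topological_tendstoD) auto
  then obtain n where n: "- (inverse (real (Suc n)) *\<^sub>R v) \<in> P"
    using interior_subset[of P] unfolding eventually_sequentially by blast
  have "inverse (real (Suc n)) *\<^sub>R v \<in> P"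
    using cone_scale[OF P v(1)] by simp
  then have "inverse (real (Suc n)) *\<^sub>R v = 0"
    using n P unfolding is_cone_def by blast
  with v show False by simp
qed

lemma eventually_interior_minus_scaled:
  fixes e :: "'e::banach"
  assumes "\<epsilon> \<in> interior P"
  shows "\<forall>\<^sub>F k in sequentially. \<epsilon> - inverse (real (Suc k)) *\<^sub>R e \<in> interior P"
proof -
  have "(\<lambda>k. \<epsilon> - inverse (real (Suc k)) *\<^sub>R e) \<longlonglongrightarrow> \<epsilon> - 0 *\<^sub>R e"
    by (intro tendsto_intros LIMSEQ_inverse_real_of_nat)
  then show ?thesis
    using assms by (intro topological_tendstoD) auto
qed

section \<open>Admissible ideals\<close>

lemma admissible_ideal_subset:
  assumes "admissible_ideal I" "A \<in> I" "B \<subseteq> A"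
  shows "B \<in> I"
  using assms unfolding admissible_ideal_def nat_ideal_def by blast

lemma admissible_ideal_Un:
  assumes "admissible_ideal I" "A \<in> I" "B \<in> I"
  shows "A \<union> B \<in> I"
  using assms unfolding admissible_ideal_def nat_ideal_def by blast

lemma admissible_ideal_empty:
  assumes "admissible_ideal I"
  shows "{} \<in> I"
  using assms admissible_ideal_subset[of I "{0}"] unfolding admissible_ideal_def by blast

lemma admissible_ideal_finite_Union:
  assumes I: "admissible_ideal I" and "finite J" "\<And>j. j \<in> J \<Longrightarrow> A j \<in> I"
  shows "(\<Union>j\<in>J. A j) \<in> I"
  using assms(2,3)
  by (induction J rule: finite_induct)
     (auto intro: admissible_ideal_empty[OF I] admissible_ideal_Un[OF I])

lemma admissible_ideal_finite:
  assumes I: "admissible_ideal I" and "finite A"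
  shows "A \<in> I"
  using admissible_ideal_finite_Union[OF I \<open>finite A\<close>, of "\<lambda>n. {n}"] I
  by (simp add: admissible_ideal_def)

lemma ideal_filter_iff: "M \<in> ideal_filter I \<longleftrightarrow> UNIV - M \<in> I"
  unfolding ideal_filter_def by (auto simp: double_diff)

lemma infinite_of_ideal_filter:
  assumes I: "admissible_ideal I" and "M \<in> ideal_filter I"
  shows "infinite M"
proof
  assume "finite M"
  then have "(UNIV - M) \<union> M \<in> I"
    using assms(2) admissible_ideal_finite[OF I \<open>finite M\<close>]
    by (intro admissible_ideal_Un[OF I]) (auto simp: ideal_filter_iff)
  then show False
    using I by (auto simp: admissible_ideal_def)
qed

section \<open>Rough convergence along a set of the filter\<close>

text \<open>
  The enumeration of \<open>M\<close> is immaterial: every tail of it omits a finite part of \<open>M\<close>, and every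
  finite part of \<open>M\<close> is missed by some tail. Members of the filter are infinite, so they can be
  enumerated.
\<close>

lemma rough_Istar_convergent_iff:
  assumes I: "admissible_ideal I"
  shows "rough_Istar_convergent P d I r x l \<longleftrightarrow>
    (\<exists>M\<in>ideal_filter I. \<forall>\<epsilon>. cone_ll P 0 \<epsilon> \<longrightarrow>
        finite {n \<in> M. r + \<epsilon> - d (x n) l \<notin> interior P})"
    (is "_ \<longleftrightarrow> (\<exists>M\<in>_. \<forall>\<epsilon>. _ \<longrightarrow> finite (?bad M \<epsilon>))")
proof
  assume "rough_Istar_convergent P d I r x l"
  then obtain m :: "nat \<Rightarrow> nat" where m: "strict_mono m" "range m \<in> ideal_filter I"
    and conv: "\<And>\<epsilon>. cone_ll P 0 \<epsilon> \<Longrightarrow> \<exists>k. \<forall>p\<ge>k. r + \<epsilon> - d (x (m p)) l \<in> interior P"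
    unfolding rough_Istar_convergent_def cone_ll_def by blast
  have "finite (?bad (range m) \<epsilon>)" if \<epsilon>: "cone_ll P 0 \<epsilon>" for \<epsilon>
  proof -
    obtain k where "\<forall>p\<ge>k. r + \<epsilon> - d (x (m p)) l \<in> interior P"
      using conv[OF \<epsilon>] by blast
    then have "?bad (range m) \<epsilon> \<subseteq> m ` {..<k}"
      by (force simp: not_le[symmetric])
    then show ?thesis
      by (rule finite_subset) simp
  qed
  with m(2) show "\<exists>M\<in>ideal_filter I. \<forall>\<epsilon>. cone_ll P 0 \<epsilon> \<longrightarrow> finite (?bad M \<epsilon>)"
    by blast
next
  assume "\<exists>M\<in>ideal_filter I. \<forall>\<epsilon>. cone_ll P 0 \<epsilon> \<longrightarrow> finite (?bad M \<epsilon>)"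
  then obtain M where M: "M \<in> ideal_filter I"
    and fin: "\<And>\<epsilon>. cone_ll P 0 \<epsilon> \<Longrightarrow> finite (?bad M \<epsilon>)"
    by blast
  have inf: "infinite M"
    using infinite_of_ideal_filter[OF I M] .
  then have m: "strict_mono (enumerate M)" "range (enumerate M) = M"
    by (simp_all add: strict_mono_enumerate range_enumerate)
  have "\<exists>k. \<forall>p\<ge>k. cone_ll P (d (x (enumerate M p)) l) (r + \<epsilon>)" if \<epsilon>: "cone_ll P 0 \<epsilon>" for \<epsilon>
  proof -
    obtain k where "\<forall>n\<in>?bad M \<epsilon>. n < k"
      using fin[OF \<epsilon>] unfolding finite_nat_set_iff_bounded by (rule exE)
    then have k: "n < k" if "n \<in> ?bad M \<epsilon>" for n
      using that by (rule bspec)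
    have "cone_ll P (d (x (enumerate M p)) l) (r + \<epsilon>)" if "k \<le> p" for p
    proof -
      have "k \<le> enumerate M p"
        using that strict_mono_imp_increasing[OF m(1), of p] by simp
      moreover have "enumerate M p \<in> M"
        using inf by (rule enumerate_in_set)
      ultimately show ?thesis
        using k[of "enumerate M p"] unfolding cone_ll_def by fastforce
    qed
    then show ?thesis by blast
  qed
  then show "rough_Istar_convergent P d I r x l"
    using m M unfolding rough_Istar_convergent_def by metis
qed

lemma rough_Istar_imp_rough_I_convergent:
  assumes I: "admissible_ideal I" and "rough_Istar_convergent P d I r x l"
  shows "rough_I_convergent P d I r x l"
  unfolding rough_I_convergent_def
proof (intro allI impI)
  fix \<epsilon> assume \<epsilon>: "cone_ll P 0 \<epsilon>"
  obtain M where M: "M \<in> ideal_filter I"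
    and fin: "finite {n \<in> M. r + \<epsilon> - d (x n) l \<notin> interior P}"
    using assms(2) \<epsilon> unfolding rough_Istar_convergent_iff[OF I] by blast
  have "(UNIV - M) \<union> {n \<in> M. r + \<epsilon> - d (x n) l \<notin> interior P} \<in> I"
    using admissible_ideal_finite[OF I fin] M
    by (intro admissible_ideal_Un[OF I]) (auto simp: ideal_filter_iff)
  then show "{n. r + \<epsilon> - d (x n) l \<notin> interior P} \<in> I"
    by (rule admissible_ideal_subset[OF I]) auto
qed

section \<open>From (AP) to rough convergence along a set\<close>

text \<open>
  Property (AP) is usable for families that overlap: disjointing keeps the partial unions, and
  a finite discrepancy in each of finitely many sets stays finite.
\<close>

lemma property_AP_pseudo_union:
  assumes I: "admissible_ideal I" and AP: "property_AP I" and C: "\<And>k::nat. C k \<in> I"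
  obtains M where "M \<in> ideal_filter I" "\<And>k. finite (C k \<inter> M)"
proof -
  have "disjointed C i \<in> I" for i
    by (rule admissible_ideal_subset[OF I C disjointed_subset])
  then obtain B where B: "\<And>i. finite ((disjointed C i - B i) \<union> (B i - disjointed C i))"
    and UB: "(\<Union>j. B j) \<in> I"
    using AP disjoint_family_disjointed[of C] unfolding property_AP_def by blast
  show thesis
  proof
    show "UNIV - (\<Union>j. B j) \<in> ideal_filter I"
      using UB by (simp add: ideal_filter_iff double_diff)
    show "finite (C k \<inter> (UNIV - (\<Union>j. B j)))" for k
    proof (rule finite_subset)
      have "C k \<subseteq> (\<Union>i\<in>{0..<Suc k}. disjointed C i)"
        unfolding finite_UN_disjointed_eq by auto
      then show "C k \<inter> (UNIV - (\<Union>j. B j)) \<subseteq> (\<Union>i\<in>{0..<Suc k}. disjointed C i - B i)"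
        by blast
      show "finite (\<Union>i\<in>{0..<Suc k}. disjointed C i - B i)"
        using B by (intro finite_UN_I) auto
    qed
  qed
qed

text \<open>
  Countably many tolerances \<open>e / (k + 1)\<close> decide convergence, and their bad sets \<open>C k\<close> all become
  finite on one set \<open>M\<close> of the filter.
\<close>

lemma AP_imp_rough_Istar_convergent:
  assumes P: "is_cone P" and I: "admissible_ideal I" and AP: "property_AP I"
    and conv: "rough_I_convergent P d I r x l"
  shows "rough_Istar_convergent P d I r x l"
proof (cases "interior P = {}")
  case True
  \<comment> \<open>There is no \<open>\<epsilon> \<ggreater> 0\<close>, so every sequence converges to every point along all of \<open>\<nat>\<close>.\<close>
  then show ?thesis
    unfolding rough_Istar_convergent_iff[OF I]
    using admissible_ideal_empty[OF I]
    by (intro bexI[of _ UNIV]) (auto simp: cone_ll_def ideal_filter_iff)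
next
  case False
  then obtain e where e: "e \<in> interior P" by blast
  define \<delta> where "\<delta> k = inverse (real (Suc k)) *\<^sub>R e" for k
  define C where "C k = {n. r + \<delta> k - d (x n) l \<notin> interior P}" for k
  have "\<delta> k \<in> interior P" for k
    unfolding \<delta>_def using e by (intro interior_cone_scale[OF P]) auto
  then have "C k \<in> I" for k
    using conv unfolding C_def rough_I_convergent_def cone_ll_def by simp
  then obtain M where M: "M \<in> ideal_filter I" and fin: "\<And>k. finite (C k \<inter> M)"
    using property_AP_pseudo_union[OF I AP] by metis
  have "finite {n \<in> M. r + \<epsilon> - d (x n) l \<notin> interior P}" if \<epsilon>: "cone_ll P 0 \<epsilon>" for \<epsilon>
  proof -
    have "\<forall>\<^sub>F k in sequentially. \<epsilon> - \<delta> k \<in> interior P"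
      unfolding \<delta>_def using \<epsilon>
      by (intro eventually_interior_minus_scaled) (simp add: cone_ll_def)
    then obtain k where k: "\<epsilon> - \<delta> k \<in> interior P"
      unfolding eventually_sequentially by blast
    have "r + \<epsilon> - d (x n) l \<in> interior P" if "n \<notin> C k" for n
    proof -
      have "(r + \<delta> k - d (x n) l) + (\<epsilon> - \<delta> k) \<in> interior P"
        using that k interior_subset[of P] unfolding C_def
        by (intro interior_cone_add[OF P]) auto
      then show ?thesis by (simp add: algebra_simps)
    qed
    then show ?thesis
      by (intro finite_subset[OF _ fin[of k]]) auto
  qed
  with M show ?thesis
    unfolding rough_Istar_convergent_iff[OF I] by blast
qed

section \<open>From equal limit sets to (AP)\<close>

text \<open>
  The cone-valued hedgehog metric: any two points are joined only through the centre, the one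
  point at which the weight \<open>g\<close> may vanish. Its use is that the distances to the centre can be prescribed freely,
  so they can accumulate at \<open>r\<close> instead of at \<open>0\<close>.
\<close>

lemma hedgehog_cone_metric_space:
  assumes P: "is_cone P" and "X \<noteq> {}"
    and g: "\<And>y. y \<in> X \<Longrightarrow> g y \<in> P"
    and inj: "\<And>y z. y \<in> X \<Longrightarrow> z \<in> X \<Longrightarrow> g y = 0 \<Longrightarrow> g z = 0 \<Longrightarrow> y = z"
  shows "cone_metric_space P X (\<lambda>y z. if y = z then 0 else g y + g z)"
proof -
  have sum_zero: "g y = 0 \<and> g z = 0" if "y \<in> X" "z \<in> X" "g y + g z = 0" for y z
  proof -
    have "- g y = g z"
      using that(3) by (simp add: add_eq_0_iff)
    then have "g y = 0"
      using P g[OF that(1)] g[OF that(2)] unfolding is_cone_def by metis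
    with that(3) show ?thesis by simp
  qed
  have distinct: "g y + g z \<noteq> 0" if "y \<in> X" "z \<in> X" "y \<noteq> z" for y z
    using sum_zero inj that by blast
  have double: "g y + g y \<in> P" if "y \<in> X" for y
    using cone_add[OF P] g that by blast
  show ?thesis
    unfolding cone_metric_space_def cone_le_def
    using \<open>X \<noteq> {}\<close> cone_zero[OF P] cone_add[OF P] g double
    by (auto simp: algebra_simps distinct)
qed

text \<open>
  The sequence exceeds the admitted distance \<open>r\<close> to the centre only on the sets \<open>A i\<close>, by the
  excess \<open>e / (i + 1)\<close>. The excesses tend to \<open>0\<close>, which gives \<open>I\<close>-convergence, but each is positive
  and constant on its \<open>A i\<close>, so along \<open>M\<close> no \<open>A i\<close> may recur infinitely often.
\<close>

lemma AP_of_rough_limit_sets_eq: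
  fixes r :: "'e::banach"
  assumes P: "is_cone P" and I: "admissible_ideal I" and r: "cone_ll P 0 r \<or> r = 0"
    and int: "interior P \<noteq> {}" and inf: "infinite (UNIV :: 'a set)"
    and eq: "\<And>(X::'a set) d x. cone_metric_space P X d \<Longrightarrow> range x \<subseteq> X \<Longrightarrow>
      rough_I_limit_set P X d I r x = rough_Istar_limit_set P X d I r x"
  shows "property_AP I"
  unfolding property_AP_def
proof (intro allI impI, elim conjE)
  fix A :: "nat \<Rightarrow> nat set"
  assume A: "\<forall>i. A i \<in> I" and disj: "disjoint_family A"
  obtain e where e: "e \<in> interior P" using int by blast
  obtain f :: "nat \<Rightarrow> 'a" where f: "inj f"
    using inf infinite_countable_subset by blast
  define \<delta> where "\<delta> i = inverse (real (Suc i)) *\<^sub>R e" for i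
  have \<delta>: "\<delta> i \<in> interior P" for i
    unfolding \<delta>_def using e by (intro interior_cone_scale[OF P]) auto
  have rP: "r \<in> P"
    using r cone_zero[OF P] interior_subset[of P] by (auto simp: cone_ll_def)
  have arm: "r + \<delta> i \<in> interior P" for i
    using interior_cone_add[OF P \<delta> rP] by (simp add: add.commute)

  \<comment> \<open>The centre is \<open>f 0\<close>, and the \<open>i\<close>-th outer point is \<open>f (Suc i)\<close>.\<close>
  define g where "g y = (case inv f y of 0 \<Rightarrow> 0 | Suc i \<Rightarrow> r + \<delta> i)" for y
  have g0: "g (f 0) = 0" and gS: "\<And>i. g (f (Suc i)) = r + \<delta> i"
    using f by (simp_all add: g_def)
  have gP: "g (f j) \<in> P" for j
    using g0 gS arm interior_subset[of P] cone_zero[OF P] by (cases j) auto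
  have g_zero: "j = 0" if "g (f j) = 0" for j
    using that gS arm zero_notin_interior_cone[OF P] by (cases j) metis+
  define d where "d y z = (if y = z then 0 else g y + g z)" for y z
  have cms: "cone_metric_space P (range f) d"
    unfolding d_def using gP g_zero by (intro hedgehog_cone_metric_space[OF P]) blast+
  have d_centre: "d y (f 0) = g y" for y
    by (simp add: d_def g0)

  define x where
    "x n = (if n \<in> (\<Union>i. A i) then f (Suc (THE i. n \<in> A i)) else f 0)" for n
  have xA: "x n = f (Suc i)" if "n \<in> A i" for n i
  proof -
    have "(THE i. n \<in> A i) = i"
      using that disj unfolding disjoint_family_on_def by (intro the_equality) blast+
    with that show ?thesis by (auto simp: x_def)
  qed
  have x0: "x n = f 0" if "n \<notin> (\<Union>i. A i)" for n
    using that by (simp add: x_def)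
  have xX: "range x \<subseteq> range f"
    by (auto simp: x_def)

  have "rough_I_convergent P d I r x (f 0)"
    unfolding rough_I_convergent_def
  proof (intro allI impI)
    fix \<epsilon> assume \<epsilon>: "cone_ll P 0 \<epsilon>"
    then obtain k where k: "\<And>i. k \<le> i \<Longrightarrow> \<epsilon> - \<delta> i \<in> interior P"
      using eventually_interior_minus_scaled[of \<epsilon> P e]
      unfolding \<delta>_def cone_ll_def eventually_sequentially by auto
    have "n \<in> (\<Union>i\<in>{..<k}. A i)" if bad: "r + \<epsilon> - d (x n) (f 0) \<notin> interior P" for n
    proof (cases "n \<in> (\<Union>i. A i)")
      case True
      then obtain i where i: "n \<in> A i" by blast
      then have "\<epsilon> - \<delta> i \<notin> interior P"
        using bad by (simp add: d_centre xA gS)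
      with k i show ?thesis
        by (meson UN_I lessThan_iff not_le)
    next
      case False
      then have "\<epsilon> + r \<notin> interior P"
        using bad by (simp add: d_centre x0 g0 add.commute)
      then show ?thesis
        using interior_cone_add[OF P _ rP] \<epsilon> by (simp add: cone_ll_def)
    qed
    then have "{n. r + \<epsilon> - d (x n) (f 0) \<notin> interior P} \<subseteq> (\<Union>i\<in>{..<k}. A i)"
      by blast
    moreover have "(\<Union>i\<in>{..<k}. A i) \<in> I"
      using A by (intro admissible_ideal_finite_Union[OF I]) auto
    ultimately show "{n. r + \<epsilon> - d (x n) (f 0) \<notin> interior P} \<in> I"
      using admissible_ideal_subset[OF I] by blast
  qed
  then have "rough_Istar_convergent P d I r x (f 0)"
    using eq[OF cms xX] unfolding rough_I_limit_set_def rough_Istar_limit_set_def by blast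
  then obtain M where M: "M \<in> ideal_filter I"
    and fin: "\<And>\<epsilon>. cone_ll P 0 \<epsilon> \<Longrightarrow>
      finite {n \<in> M. r + \<epsilon> - d (x n) (f 0) \<notin> interior P}"
    unfolding rough_Istar_convergent_iff[OF I] by blast

  have "finite (A i \<inter> M)" for i
  proof -
    \<comment> \<open>With tolerance \<open>\<delta> i\<close> the slack on \<open>A i\<close> is exactly \<open>0\<close>, which is not interior.\<close>
    have "r + \<delta> i - d (x n) (f 0) = 0" if "n \<in> A i" for n
      using that by (simp add: d_centre xA gS)
    then have "A i \<inter> M \<subseteq> {n \<in> M. r + \<delta> i - d (x n) (f 0) \<notin> interior P}"
      using zero_notin_interior_cone[OF P] by auto
    moreover have "finite {n \<in> M. r + \<delta> i - d (x n) (f 0) \<notin> interior P}"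
      using fin \<delta> by (simp add: cone_ll_def)
    ultimately show ?thesis
      by (rule finite_subset)
  qed
  moreover have "A i - (A i - M) \<union> (A i - M - A i) = A i \<inter> M" for i
    by blast
  moreover have "(\<Union>j. A j - M) \<in> I"
    using M by (auto simp: ideal_filter_iff intro: admissible_ideal_subset[OF I])
  ultimately show "\<exists>B. (\<forall>i. finite ((A i - B i) \<union> (B i - A i))) \<and> (\<Union>j. B j) \<in> I"
    by (intro exI[of _ "\<lambda>i. A i - M"]) simp
qed

theorem corollary3:
  fixes P :: "'e::banach set" and I :: "nat set set" and r :: 'e
  assumes "is_cone P"
    and "admissible_ideal I"
    and "cone_ll P 0 r \<or> r = 0"
  shows "(property_AP I \<longrightarrow>
            (\<forall>(X::'a set) d x. cone_metric_space P X d \<and> range x \<subseteq> X \<longrightarrow>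
               rough_I_limit_set P X d I r x = rough_Istar_limit_set P X d I r x)) \<and>
         (interior P \<noteq> {} \<and> infinite (UNIV :: 'a set) \<longrightarrow>
            ((\<forall>(X::'a set) d x. cone_metric_space P X d \<and> range x \<subseteq> X \<longrightarrow>
               rough_I_limit_set P X d I r x = rough_Istar_limit_set P X d I r x)
             \<longleftrightarrow> property_AP I))"
proof -
  have eq: "rough_I_limit_set P X d I r x = rough_Istar_limit_set P X d I r x"
    if "property_AP I" for X :: "'a set" and d x
  proof -
    have "rough_I_convergent P d I r x l \<longleftrightarrow> rough_Istar_convergent P d I r x l" for l
      using AP_imp_rough_Istar_convergent[OF assms(1,2) that]
        rough_Istar_imp_rough_I_convergent[OF assms(2)]
      by (rule iffI)
    then show ?thesis
      unfolding rough_I_limit_set_def rough_Istar_limit_set_def by simp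
  qed
  moreover have "property_AP I"
    if "interior P \<noteq> {}" "infinite (UNIV :: 'a set)"
      and "\<forall>(X::'a set) d x. cone_metric_space P X d \<and> range x \<subseteq> X \<longrightarrow>
        rough_I_limit_set P X d I r x = rough_Istar_limit_set P X d I r x"
    using AP_of_rough_limit_sets_eq[OF assms that(1,2)] that(3) by blast
  ultimately show ?thesis by blast
qed

end
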